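(* Let $G$ be an abelian group without $2$-torsion and without $3$-torsion. Then $\mathbb{Z}[\mathrm{Core}(G)]$ has no non-trivial idempotent built up with at most three distinct basis elements; that is, if $u=\alpha e_x+\beta e_y+\gamma e_z$ with $x,y,z\in G$ and $\alpha,\beta,\gamma\in\mathbb{Z}$ is an idempotent, then $u=e_g$ for some $g\in G$.
   Context: For an abelian group $G$ (written additively), the core quandle $\mathrm{Core}(G)$ is the set $G$ with the operation $x*y=2y-x$. For a quandle $X$, the quandle ring $\mathbb{Z}[X]$ is the free $\mathbb{Z}$-module with basis $\{e_x\mid x\in X\}$ with the (in general non-associative) bilinear product determined by $e_xe_y=e_{x*y}$. An idempotent is a non-zero $u$ with $u^2=u$; it is non-trivial if it is not of the form $e_x$. *)

theory Defs
  imports "HOL-Library.Poly_Mapping"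
begin

locale quandle =
  fixes op :: "'a \<Rightarrow> 'a \<Rightarrow> 'a"
  assumes idem: "op x x = x"
    and right_bij: "bij (\<lambda>x. op x y)"
    and right_distrib: "op (op x y) z = op (op x z) (op y z)"

definition core_op :: "'a::ab_group_add \<Rightarrow> 'a \<Rightarrow> 'a" where
  "core_op x y = y + y - x"

lemma quandle_core: "quandle (core_op :: 'a::ab_group_add \<Rightarrow> 'a \<Rightarrow> 'a)"
proof
  fix x y z :: 'a
  show "core_op x x = x"
    by (simp add: core_op_def)
  show "bij (\<lambda>x. core_op x y)"
    by (rule involuntory_imp_bij) (simp add: core_op_def)
  show "core_op (core_op x y) z = core_op (core_op x z) (core_op y z)"
    by (simp add: core_op_def algebra_simps)
qed

text \<open>The underlying module of the quandle ring of a quandle on the type \<open>'a\<close> is the free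
  abelian group \<open>'a \<Rightarrow>\<^sub>0 int\<close> with basis \<open>frag_of x\<close> and scalar multiplication \<open>frag_cmul\<close>.
  The ring product is not the convolution product \<open>(*)\<close> that the library puts on this type
  for an additive monoid \<open>'a\<close>; it is the bilinear extension of \<open>op\<close>.\<close>

definition quandle_mult :: "('a \<Rightarrow> 'a \<Rightarrow> 'a) \<Rightarrow> ('a \<Rightarrow>\<^sub>0 int) \<Rightarrow> ('a \<Rightarrow>\<^sub>0 int) \<Rightarrow> ('a \<Rightarrow>\<^sub>0 int)" where
  "quandle_mult op u v = frag_extend (\<lambda>x. frag_extend (\<lambda>y. frag_of (op x y)) v) u"

lemma quandle_mult_basis:
  "quandle_mult op (frag_of x) (frag_of y) = frag_of (op x y)"
  by (simp add: quandle_mult_def)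

lemma quandle_mult_add_left:
  "quandle_mult op (u + u') v = quandle_mult op u v + quandle_mult op u' v"
  by (simp add: quandle_mult_def frag_extend_add)

lemma quandle_mult_add_right:
  "quandle_mult op u (v + v') = quandle_mult op u v + quandle_mult op u v'"
  by (simp add: quandle_mult_def frag_extend_add) (simp add: frag_extend_def frag_cmul_distrib2 sum.distrib)

definition quandle_idempotent :: "('a \<Rightarrow> 'a \<Rightarrow> 'a) \<Rightarrow> ('a \<Rightarrow>\<^sub>0 int) \<Rightarrow> bool" where
  "quandle_idempotent op u \<longleftrightarrow> u \<noteq> 0 \<and> quandle_mult op u u = u"

end

theory Submission
  imports Defs
begin

text \<open>Compare coefficients in \<open>u\<^sup>2 = u\<close>. Without 2-torsion, \<open>core_op p q\<close> differs from \<open>p\<close> and \<open>q\<close>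
  for \<open>p \<noteq> q\<close>. If no basis element is the midpoint of the other two, then every coefficient satisfies
  \<open>c\<^sup>2 = c\<close>, hence is 0 or 1, and the coefficient of \<open>u\<^sup>2\<close> at \<open>core_op p q\<close>, which is a sum of
  nonnegative terms including the product of the coefficients of \<open>p\<close> and \<open>q\<close>, must vanish. If \<open>y\<close> is
  the midpoint of \<open>x\<close> and \<open>z\<close>, it is the only midpoint because there is no 3-torsion, and the
  coefficients satisfy \<open>\<beta>\<^sup>2 = \<beta>\<close>, \<open>\<alpha>\<^sup>2 + \<beta>\<gamma> = \<alpha>\<close> and \<open>\<gamma>\<^sup>2 + \<alpha>\<beta> = \<gamma>\<close>. For \<open>\<beta> = 1\<close> the last two
  add up to \<open>\<alpha>\<^sup>2 + \<gamma>\<^sup>2 = 0\<close>; for \<open>\<beta> = 0\<close> one argues as before.\<close>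

lemma quandle_mult_cmul_left:
  "quandle_mult op (frag_cmul a u) v = frag_cmul a (quandle_mult op u v)"
  by (simp add: quandle_mult_def frag_extend_cmul)

lemma quandle_mult_cmul_right:
  "quandle_mult op u (frag_cmul a v) = frag_cmul a (quandle_mult op u v)"
  by (simp add: quandle_mult_def frag_extend_cmul)
    (simp add: frag_extend_def frag_cmul_sum mult.left_commute)

lemma lookup_frag_of_bool: "Poly_Mapping.lookup (frag_of x) g = of_bool (x = g)"
  by simp

lemma core_op_right_inverse: "core_op (core_op x y) y = x"
  by (simp add: core_op_def)

text \<open>Right multiplication by \<open>y\<close> is the point reflection in \<open>y\<close>, an
  involution. So both equations say that \<open>y\<close> is a midpoint of \<open>x\<close> and
  \<open>z\<close>.\<close>

lemma core_op_swap: "core_op x y = z \<longleftrightarrow> core_op z y = (x::'a::ab_group_add)"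
  by (auto simp: core_op_right_inverse)

lemma core_op_eq_right_iff: "core_op x y = y \<longleftrightarrow> x = (y::'a::ab_group_add)"
  by (auto simp: core_op_def algebra_simps)

lemma core_op_self: "core_op x x = (x::'a::ab_group_add)"
  by (simp add: core_op_eq_right_iff)

text \<open>Bilinear expansion of both sides of \<open>u * u = u\<close> in the quandle ring, read
  off at \<open>g\<close>. The indicators leave open which of the basis elements and products
  coincide, so degenerate instances are covered as well.\<close>

lemma idempotent_coefficient:
  fixes x y z g :: "'a::ab_group_add"
  assumes "quandle_idempotent core_op
    (frag_cmul \<alpha> (frag_of x) + frag_cmul \<beta> (frag_of y) + frag_cmul \<gamma> (frag_of z))"
  shows "\<alpha> * \<alpha> * of_bool (x = g) + \<beta> * \<beta> * of_bool (y = g) + \<gamma> * \<gamma> * of_bool (z = g)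
    + \<alpha> * \<beta> * (of_bool (core_op x y = g) + of_bool (core_op y x = g))
    + \<alpha> * \<gamma> * (of_bool (core_op x z = g) + of_bool (core_op z x = g))
    + \<beta> * \<gamma> * (of_bool (core_op y z = g) + of_bool (core_op z y = g))
    = \<alpha> * of_bool (x = g) + \<beta> * of_bool (y = g) + \<gamma> * of_bool (z = g)"
proof -
  define u where "u = frag_cmul \<alpha> (frag_of x) + frag_cmul \<beta> (frag_of y) + frag_cmul \<gamma> (frag_of z)"
  have "Poly_Mapping.lookup (quandle_mult core_op u u) g = Poly_Mapping.lookup u g"
    using assms by (simp add: quandle_idempotent_def u_def)
  then show ?thesis
    unfolding u_def
    by (simp add: quandle_mult_add_left quandle_mult_add_right quandle_mult_cmul_left
        quandle_mult_cmul_right quandle_mult_basis lookup_add lookup_frag_of_bool core_op_self distrib_left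
        mult.commute mult.left_commute del: lookup_frag_of)
qed

lemma int_idempotent_cases: "a = 0 \<or> a = 1" if "a * a = (a::int)"
  using that by simp

context
  fixes x y z :: "'a::ab_group_add"
  assumes no_2_torsion: "\<And>g::'a. g + g = 0 \<Longrightarrow> g = 0"
begin

lemma core_op_eq_left_iff: "core_op p q = p \<longleftrightarrow> p = (q::'a)"
proof
  assume "core_op p q = p"
  then have "(q - p) + (q - p) = 0"
    by (simp add: core_op_def algebra_simps)
  then show "p = q"
    using no_2_torsion[of "q - p"] by simp
qed (simp add: core_op_self)

text \<open>Handles what remains after merging two equal elements among three; \<open>x = y\<close>
  is allowed, so the case of three equal elements is included.\<close>

lemma idempotent_two_basis_elements:
  assumes u: "u = frag_cmul \<alpha> (frag_of x) + frag_cmul \<beta> (frag_of y)"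
    and idem: "quandle_idempotent core_op u"
  shows "\<exists>g. u = frag_of g"
proof -
  note coeff = idempotent_coefficient[of \<alpha> x \<beta> y 0 y, simplified, folded u, OF idem]
  have "u \<noteq> 0"
    using idem by (simp add: quandle_idempotent_def)
  show ?thesis
  proof (cases "x = y")
    case True
    have "u = frag_cmul (\<alpha> + \<beta>) (frag_of x)"
      using u True by (simp add: frag_cmul_distrib)
    moreover have "\<alpha> + \<beta> = 0 \<or> \<alpha> + \<beta> = 1"
      using coeff[of x] True by (intro int_idempotent_cases) (simp add: core_op_self algebra_simps)
    ultimately show ?thesis
      using \<open>u \<noteq> 0\<close> by auto
  next
    case False
    note simps = False False[symmetric] core_op_eq_left_iff core_op_eq_right_iff
      core_op_eq_left_iff[THEN eq_iff_swap] core_op_eq_right_iff[THEN eq_iff_swap]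
    have "\<alpha> = 0 \<or> \<alpha> = 1" "\<beta> = 0 \<or> \<beta> = 1"
      using coeff[of x] coeff[of y] by (auto simp: simps)
    \<comment> \<open>\<open>core_op x y\<close> is neither \<open>x\<close> nor \<open>y\<close>,
      so \<open>u\<close> has coefficient 0 there, while the square has at least
      \<alpha>\<beta>.\<close>
    moreover have "\<not> (\<alpha> = 1 \<and> \<beta> = 1)"
      using coeff[of "core_op x y"] by (auto simp: simps of_bool_def split: if_splits)
    ultimately show ?thesis
      using u \<open>u \<noteq> 0\<close> by auto
  qed
qed

context
  fixes \<alpha> \<beta> \<gamma> :: int and u :: "'a \<Rightarrow>\<^sub>0 int"
  assumes distinct: "x \<noteq> y" "x \<noteq> z" "y \<noteq> z"
    and u: "u = frag_cmul \<alpha> (frag_of x) + frag_cmul \<beta> (frag_of y) + frag_cmul \<gamma> (frag_of z)"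
    and idem: "quandle_idempotent core_op u"
begin

lemmas three_simps = distinct distinct[symmetric] core_op_eq_left_iff core_op_eq_right_iff
  core_op_eq_left_iff[THEN eq_iff_swap] core_op_eq_right_iff[THEN eq_iff_swap]

lemmas coeff = idempotent_coefficient[of \<alpha> x \<beta> y \<gamma> z, folded u, OF idem]

text \<open>The assumptions exclude \<open>y\<close>, \<open>x\<close> and \<open>z\<close>, in this
  order, as midpoint of the other two; \<open>core_op_swap\<close> then keeps all six mixed products
  away from \<open>x\<close>, \<open>y\<close>, \<open>z\<close>.\<close>

lemma idempotent_no_midpoint:
  assumes "core_op x y \<noteq> z" "core_op y x \<noteq> z" "core_op x z \<noteq> y"
  shows "\<exists>g. u = frag_of g"
proof -
  have neq: "core_op z y \<noteq> x" "core_op z x \<noteq> y" "core_op y z \<noteq> x"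
    using assms core_op_swap by metis+
  note simps = three_simps assms assms[symmetric] neq neq[symmetric]
  have "u \<noteq> 0"
    using idem by (simp add: quandle_idempotent_def)
  moreover have cases: "\<alpha> = 0 \<or> \<alpha> = 1" "\<beta> = 0 \<or> \<beta> = 1" "\<gamma> = 0 \<or> \<gamma> = 1"
    using coeff[of x] coeff[of y] coeff[of z] by (auto simp: simps)
  \<comment> \<open>Other mixed products may also land on \<open>core_op x y\<close>;
    \<open>cases\<close> makes their contributions nonnegative, so nothing can cancel.\<close>
  moreover have "\<not> (\<alpha> = 1 \<and> \<beta> = 1)"
    using coeff[of "core_op x y"] cases by (auto simp: simps of_bool_def split: if_splits)
  moreover have "\<not> (\<alpha> = 1 \<and> \<gamma> = 1)"
    using coeff[of "core_op x z"] cases by (auto simp: simps of_bool_def split: if_splits)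
  moreover have "\<not> (\<beta> = 1 \<and> \<gamma> = 1)"
    using coeff[of "core_op y z"] cases by (auto simp: simps of_bool_def split: if_splits)
  ultimately show ?thesis
    using u by auto
qed

lemma idempotent_midpoint:
  assumes no_3_torsion: "\<And>g::'a. g + g + g = 0 \<Longrightarrow> g = 0"
    and mid: "core_op x y = z"
  shows "\<exists>g. u = frag_of g"
proof -
  have mid': "core_op z y = x"
    using mid by (rule core_op_swap[THEN iffD1])
  have z: "z = y + y - x"
    using mid by (simp add: core_op_def)
  have "core_op y x \<noteq> z"
  proof
    assume "core_op y x = z"
    then have "(x - y) + (x - y) + (x - y) = 0"
      by (simp add: core_op_def z algebra_simps)
    then show False
      using no_3_torsion[of "x - y"] distinct by simp
  qed
  moreover have "core_op x z \<noteq> y"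
  proof
    assume "core_op x z = y"
    then have "(y - x) + (y - x) + (y - x) = 0"
      by (simp add: core_op_def z algebra_simps)
    then show False
      using no_3_torsion[of "y - x"] distinct by simp
  qed
  ultimately have neq: "core_op y x \<noteq> z" "core_op z x \<noteq> y" "core_op x z \<noteq> y" "core_op y z \<noteq> x"
    using core_op_swap[of y x z] core_op_swap[of x z y] by blast+
  note simps = three_simps mid mid' neq neq[symmetric]
  have "u \<noteq> 0"
    using idem by (simp add: quandle_idempotent_def)
  \<comment> \<open>The only mixed products that hit \<open>x\<close>, \<open>y\<close> or
    \<open>z\<close> are \<open>core_op z y = x\<close> and \<open>core_op x y = z\<close>.\<close>
  have x: "\<alpha> * \<alpha> + \<beta> * \<gamma> = \<alpha>" and z: "\<gamma> * \<gamma> + \<alpha> * \<beta> = \<gamma>" and y: "\<beta> = 0 \<or> \<beta> = 1"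
    using coeff[of x] coeff[of y] coeff[of z] by (auto simp: simps)
  show ?thesis
  proof (cases "\<beta> = 0")
    case True
    then have "\<alpha> = 0 \<or> \<alpha> = 1" "\<gamma> = 0 \<or> \<gamma> = 1"
      using x z by auto
    moreover have "\<not> (\<alpha> = 1 \<and> \<gamma> = 1)"
      using coeff[of "core_op x z"] True by (auto simp: simps of_bool_def split: if_splits)
    ultimately show ?thesis
      using u True \<open>u \<noteq> 0\<close> by auto
  next
    case False
    then have "\<beta> = 1"
      using y by simp
    then have "\<alpha> * \<alpha> + \<gamma> * \<gamma> = 0"
      using x z by simp
    then have "\<alpha> = 0 \<and> \<gamma> = 0"
      by (simp add: sum_squares_eq_zero_iff)
    then show ?thesis
      using u \<open>\<beta> = 1\<close> by auto
  qed
qed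

end

end

theorem proposition3p11:
  fixes x y z :: "'a::ab_group_add"
    and \<alpha> \<beta> \<gamma> :: int
    and u :: "'a \<Rightarrow>\<^sub>0 int"
  assumes no_2_torsion: "\<And>g::'a. g + g = 0 \<Longrightarrow> g = 0"
    and no_3_torsion: "\<And>g::'a. g + g + g = 0 \<Longrightarrow> g = 0"
    and u: "u = frag_cmul \<alpha> (frag_of x) + frag_cmul \<beta> (frag_of y) + frag_cmul \<gamma> (frag_of z)"
    and idem: "quandle_idempotent core_op u"
  shows "\<exists>g. u = frag_of g"
proof -
  consider "x = y" | "x = z" | "y = z" | "x \<noteq> y" "x \<noteq> z" "y \<noteq> z"
    by blast
  then show ?thesis
  proof cases
    case 1
    then have "u = frag_cmul (\<alpha> + \<beta>) (frag_of x) + frag_cmul \<gamma> (frag_of z)"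
      using u by (simp add: frag_cmul_distrib)
    then show ?thesis
      using idempotent_two_basis_elements[OF no_2_torsion _ idem] by blast
  next
    case 2
    then have "u = frag_cmul (\<alpha> + \<gamma>) (frag_of x) + frag_cmul \<beta> (frag_of y)"
      using u by (simp add: frag_cmul_distrib algebra_simps)
    then show ?thesis
      using idempotent_two_basis_elements[OF no_2_torsion _ idem] by blast
  next
    case 3
    then have "u = frag_cmul \<alpha> (frag_of x) + frag_cmul (\<beta> + \<gamma>) (frag_of y)"
      using u by (simp add: frag_cmul_distrib algebra_simps)
    then show ?thesis
      using idempotent_two_basis_elements[OF no_2_torsion _ idem] by blast
  next
    case 4
    \<comment> \<open>Reorderings that put \<open>x\<close>, respectively \<open>z\<close>, in the
      middle place, where \<open>idempotent_midpoint\<close> expects the midpoint.\<close>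
    have u': "u = frag_cmul \<beta> (frag_of y) + frag_cmul \<alpha> (frag_of x) + frag_cmul \<gamma> (frag_of z)"
      "u = frag_cmul \<alpha> (frag_of x) + frag_cmul \<gamma> (frag_of z) + frag_cmul \<beta> (frag_of y)"
      using u by (simp_all add: algebra_simps)
    consider "core_op x y = z" | "core_op y x = z" | "core_op x z = y"
      | "core_op x y \<noteq> z" "core_op y x \<noteq> z" "core_op x z \<noteq> y"
      by blast
    then show ?thesis
    proof cases
      case 1
      show ?thesis
        by (rule idempotent_midpoint[OF no_2_torsion _ _ _ u idem no_3_torsion 1]) (use 4 in auto)
    next
      case 2
      show ?thesis
        by (rule idempotent_midpoint[OF no_2_torsion _ _ _ u'(1) idem no_3_torsion 2]) (use 4 in auto)
    next
      case 3
      show ?thesis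
        by (rule idempotent_midpoint[OF no_2_torsion _ _ _ u'(2) idem no_3_torsion 3]) (use 4 in auto)
    next
      case no_midpoint: 4
      show ?thesis
        by (rule idempotent_no_midpoint[OF no_2_torsion 4 u idem no_midpoint])
    qed
  qed
qed

end
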